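(* For every integer $n\geq 0$, there is a $\tfrac{4}{3}^+$-free circular word of length $2n+1$ over an alphabet of $5$ letters.
   Context: A word $w=w_1\cdots w_n$ has period $p\ge 1$ if $w_{i+p}=w_i$ for all $1\le i\le n-p$ (so $n$ is always a period). The exponent of a nonempty word is its length divided by its minimal period. Two words $x,y$ are conjugates if $x=uv$ and $y=vu$ for some words $u,v$. For a word $w$, the circular word $(w)$ is the set of all conjugates of $w$; its length is $|w|$. A word is a factor of $(w)$ if it is a (contiguous) factor of some conjugate of $w$. A (linear or circular) word is $\beta^+$-free if it has no factor of exponent strictly greater than $\beta$. *)

theory Defs
  imports Complex_Main "HOL-Library.Sublist"
begin

text \<open>Words are lists, indexed from 0. Any \<open>p \<ge> length w\<close> with \<open>p \<ge> 1\<close> is vacuously a period.\<close>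

definition has_period :: "'a list \<Rightarrow> nat \<Rightarrow> bool" where
  "has_period w p \<longleftrightarrow> 1 \<le> p \<and> (\<forall>i. i + p < length w \<longrightarrow> w ! (i + p) = w ! i)"

definition min_period :: "'a list \<Rightarrow> nat" where
  "min_period w = (LEAST p. has_period w p)"

text \<open>Only meaningful for nonempty words.\<close>

definition word_exponent :: "'a list \<Rightarrow> real" where
  "word_exponent w = real (length w) / real (min_period w)"

definition conjugates :: "'a list \<Rightarrow> 'a list \<Rightarrow> bool" where
  "conjugates x y \<longleftrightarrow> (\<exists>u v. x = u @ v \<and> y = v @ u)"

definition circular_word :: "'a list \<Rightarrow> 'a list set" where
  "circular_word w = {x. conjugates w x}"

text \<open>A factor of a circular word lies inside a single conjugate, so it is never longer than
  the circular word itself.\<close>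

definition circular_factor :: "'a list \<Rightarrow> 'a list set \<Rightarrow> bool" where
  "circular_factor z C \<longleftrightarrow> (\<exists>x\<in>C. sublist z x)"

definition circular_plus_free :: "real \<Rightarrow> 'a list set \<Rightarrow> bool" where
  "circular_plus_free \<beta> C \<longleftrightarrow> \<not> (\<exists>z. z \<noteq> [] \<and> circular_factor z C \<and> word_exponent z > \<beta>)"

end

theory Submission
  imports Defs "HOL-Combinatorics.Transposition"
begin

text \<open>
  Call a circular word strict if all its exponents are less than \<open>4/3\<close>. A suitable uniform morphism
  maps strict circular words to strict (or to \<open>4/3\<close>-plus-free) ones: short repetitions are excluded
  by inspecting images of three letters, and long ones synchronise with the blocks and therefore stem
  from repetitions of the source, whose strictness leaves room for the common prefixes and suffixes
  of the blocks. To reach lengths that are not multiples of the block length, one word \<open>U\<close> is inserted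
  between two blocks, all of whose long factors occur nowhere else; after renaming letters
  the two blocks on either side of \<open>U\<close> are always the same.

  A \<open>13\<close>-uniform morphism on seven letters, with insertions of lengths \<open>1\<close> to \<open>13\<close>, produces strict
  circular words of all lengths \<open>N \<ge> 4\<close> from those with \<open>N \<le> 52\<close>. An \<open>18\<close>-uniform morphism from
  seven to five letters, with insertions of the odd lengths \<open>5\<close> to \<open>21\<close>, then yields all odd
  lengths from \<open>77\<close> on.
\<close>

subsection \<open>Uniform morphisms with an insertion\<close>

text \<open>
  The parameter \<open>d\<close> distinguishes the weak condition \<open>d = 0\<close> (exponents at most \<open>4/3\<close>) from the
  strict one \<open>d = 1\<close> (exponents less than \<open>4/3\<close>): a factor of length \<open>l + p\<close> with period \<open>p\<close>
  exceeds the bound iff \<open>3 l + d > p\<close>.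
\<close>

definition circ_free :: "nat \<Rightarrow> 'a list \<Rightarrow> bool" where
  "circ_free d w \<longleftrightarrow>
    (\<forall>i p l. 0 < p \<and> p < length w \<and>
      (\<forall>k<l. w ! ((i + k) mod length w) = w ! ((i + p + k) mod length w)) \<longrightarrow> 3 * l + d \<le> p)"

text \<open>The least \<open>l\<close> with \<open>3 l + d > p\<close>.\<close>

definition forbidden_run :: "nat \<Rightarrow> nat \<Rightarrow> nat" where
  "forbidden_run d p = (p - d) div 3 + 1"

text \<open>For each period only the shortest forbidden run is tested, since every longer run begins
  with it; this keeps the condition finitely checkable.\<close>

definition short_free :: "nat \<Rightarrow> nat \<Rightarrow> 'a list \<Rightarrow> bool" where
  "short_free d P w \<longleftrightarrow>
    (\<forall>i p. 0 < p \<and> p \<le> P \<and> i + p + forbidden_run d p \<le> length w \<longrightarrow>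
      (\<exists>k<forbidden_run d p. w ! (i + k) \<noteq> w ! (i + p + k)))"

section \<open>Forbidden runs and elementary consequences of circular freeness\<close>

lemma forbidden_run_le:
  assumes "\<not> 3 * l + d \<le> p" "d \<le> 1" "0 < p"
  shows "forbidden_run d p \<le> l"
  using assms unfolding forbidden_run_def by linarith

text \<open>The bound recurs in both locales below: larger periods have forbidden runs of at least
  \<open>q\<close> letters, and these are treated by synchronisation instead of inspection.\<close>

lemma forbidden_run_less:
  assumes "forbidden_run d p < q"
  shows "p \<le> 3 * (q - 1) + d - 1"
  using assms unfolding forbidden_run_def by linarith

lemma less_forbidden_run: "p < 3 * forbidden_run d p + d"
proof -
  have "p - d < 3 * ((p - d) div 3 + 1)" by simp
  then show ?thesis unfolding forbidden_run_def by linarith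
qed

lemma circ_freeD:
  assumes "circ_free d w" "0 < p" "p < length w"
    and "\<And>k. k < l \<Longrightarrow> w ! ((i + k) mod length w) = w ! ((i + p + k) mod length w)"
  shows "3 * l + d \<le> p"
  using assms unfolding circ_free_def by blast

lemma circ_free_map:
  assumes "inj_on f (set w)" "circ_free d w"
  shows "circ_free d (map f w)"
  unfolding circ_free_def
proof (intro allI impI, elim conjE)
  fix i p l assume p: "0 < p" "p < length (map f w)"
    and k: "\<forall>k<l. map f w ! ((i + k) mod length (map f w)) = map f w ! ((i + p + k) mod length (map f w))"
  have "0 < length w" using p by (cases w) auto
  then have "w ! ((i + k) mod length w) = w ! ((i + p + k) mod length w)" if "k < l" for k
    using k that assms(1) by (auto simp: inj_on_eq_iff)
  with p show "3 * l + d \<le> p" by (intro circ_freeD[OF assms(2)]) auto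
qed

text \<open>An equal pair at distance \<open>r\<close> is a run of length 1, which
  \<open>d = 1\<close> permits only for \<open>r \<ge> 4\<close>. In this form strictness feeds
  \<open>sync\<close>, \<open>short\<close> and the relabelling.\<close>

lemma circ_free_neq:
  assumes "circ_free 1 w" "i < length w" "0 < r" "r \<le> 3" "r < length w"
  shows "w ! i \<noteq> w ! ((i + r) mod length w)"
proof
  assume "w ! i = w ! ((i + r) mod length w)"
  then have "3 * 1 + 1 \<le> r"
    using assms by (intro circ_freeD[OF assms(1), of r 1 i]) auto
  then show False using assms by simp
qed

lemma short_freeD:
  assumes "short_free d P w" "0 < p" "p \<le> P" "i + p + forbidden_run d p \<le> length w"
  obtains k where "k < forbidden_run d p" "w ! (i + k) \<noteq> w ! (i + p + k)"
  using assms unfolding short_free_def by blast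

lemma concat_map_split:
  assumes "\<And>x. length (h x) = m" "k \<le> length w"
  shows "concat (map h w) ! (m * k + s) = concat (map h (drop k w)) ! s"
proof -
  have "length (concat (map h (take k w))) = m * k"
    using assms by (simp add: length_concat comp_def sum_list_triv)
  moreover have "concat (map h w) = concat (map h (take k w)) @ concat (map h (drop k w))"
    by (metis append_take_drop_id concat_append map_append)
  ultimately show ?thesis by (simp add: nth_append)
qed

text \<open>
  Windows of length \<open>q\<close> in an image determine their offset modulo \<open>m\<close>, so repetitions of length at
  least \<open>q\<close> come from the source, up to \<open>es\<close> letters on the left and \<open>ep\<close> letters on the right.
  The inequality \<open>ends\<close> is where the strictness of the source is spent: \<open>3 x + 1 \<le> p\<close> in the source
  gives \<open>3 m x + 3 (ep + es) + d \<le> m p\<close> in the image.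
\<close>

locale uniform_map =
  fixes h :: "'a \<Rightarrow> 'b list" and m q d ep es :: nat
  assumes len: "length (h x) = m"
    and d_le: "d \<le> 1"
    and ends: "3 * (ep + es) + d \<le> m"
    and q_pos: "0 < q"
    and q_le: "q \<le> m"
    and q_bound: "4 * q + d \<le> 2 * m + 6"
    and prefix: "x \<noteq> y \<Longrightarrow> \<exists>u\<le>ep. h x ! u \<noteq> h y ! u"
    and suffix: "x \<noteq> y \<Longrightarrow> \<exists>u<m. m \<le> u + 1 + es \<and> h x ! u \<noteq> h y ! u"
    and sync: "x \<noteq> y \<Longrightarrow> x' \<noteq> y' \<Longrightarrow> s < m \<Longrightarrow> s' < m \<Longrightarrow>
      (\<And>k. k < q \<Longrightarrow> (h x @ h y) ! (s + k) = (h x' @ h y') ! (s' + k)) \<Longrightarrow> s = s'"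
    and sync_letter: "s + q \<le> m \<Longrightarrow> (\<And>k. k < q \<Longrightarrow> h x ! (s + k) = h y ! (s + k)) \<Longrightarrow> x = y"
    and short: "distinct [x, y, z] \<Longrightarrow> short_free d (3 * (q - 1) + d - 1) (h x @ h y @ h z)"
begin

section \<open>Letters of an image and its long linear repetitions\<close>

lemma m_pos: "0 < m"
  using q_pos q_le by simp

lemma length_image: "length (concat (map h w)) = m * length w"
  by (simp add: length_concat comp_def len sum_list_triv)

lemma image_nth:
  assumes "k < length w" "u < m"
  shows "concat (map h w) ! (m * k + u) = h (w ! k) ! u"
  using assms concat_map_split[of h m k w u]
  by (simp add: len Cons_nth_drop_Suc[symmetric] nth_append)

lemma image_nth2:
  assumes "k + 1 < length w" "s < 2 * m"
  shows "concat (map h w) ! (m * k + s) = (h (w ! k) @ h (w ! (k + 1))) ! s"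
  using assms concat_map_split[of h m k w s]
  by (auto simp: len Cons_nth_drop_Suc[symmetric] nth_append)

lemma image_nth3:
  assumes "k + 2 < length w" "s < 3 * m"
  shows "concat (map h w) ! (m * k + s) = (h (w ! k) @ h (w ! (k + 1)) @ h (w ! (k + 2))) ! s"
  using assms concat_map_split[of h m k w s]
  by (auto simp: len Cons_nth_drop_Suc[symmetric] nth_append)

text \<open>Two blocks suffice because \<open>t \<le> m\<close>. The second index is cyclic so that
  its letter differs from the first even at the last block; there the position stays inside the
  first block and the second is never read.\<close>

lemma image_window:
  assumes "i + t < m * length w" "t \<le> m"
  shows "concat (map h w) ! (i + t) =
    (h (w ! (i div m)) @ h (w ! ((i div m + 1) mod length w))) ! (i mod m + t)"
proof -
  define k s where "k = i div m" and "s = i mod m"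
  have i: "i = m * k + s" "s < m" using m_pos by (auto simp: k_def s_def)
  have "k < length w" using assms i
    by (metis add_lessD1 mult_less_cancel1)
  show ?thesis
  proof (cases "k + 1 < length w")
    case True
    then show ?thesis
      using image_nth2[of k w "s + t"] i assms by (simp flip: k_def s_def add: add.assoc)
  next
    case False
    then have kN: "length w = k + 1" using \<open>k < length w\<close> by simp
    then have "s + t < m" using assms i by simp
    then show ?thesis
      using image_nth[of k w "s + t"] i kN by (simp flip: k_def s_def add: add.assoc nth_append len)
  qed
qed

text \<open>Synchronisation makes the distance a multiple \<open>m * p\<close>, and the run covers a
  source run at distance \<open>p\<close>. This is also a run at distance
  \<open>length w - p\<close>; both bounds are kept because on the circle either occurrence may come
  first.\<close>

lemma linear_run:
  assumes w: "circ_free 1 w" and N: "2 \<le> length w"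
    and ij: "i < j" "j + l \<le> m * length w" and l: "q \<le> l"
    and run: "\<And>k. k < l \<Longrightarrow> concat (map h w) ! (i + k) = concat (map h w) ! (j + k)"
  obtains p where "j - i = m * p" "0 < p" "p < length w"
    "3 * l + d \<le> m * p" "3 * l + d \<le> m * (length w - p)"
proof -
  define N where "N = length w"
  define k0 k1 s where "k0 = i div m" and "k1 = j div m" and "s = i mod m"
  have k0N: "k0 < N" and k1N: "k1 < N"
    using ij l q_pos m_pos unfolding N_def k0_def k1_def
    by (auto simp: less_mult_imp_div_less mult.commute)
  have neq: "w ! k \<noteq> w ! ((k + 1) mod N)" if "k < N" for k
    using circ_free_neq[OF w, of k 1] that N by (simp add: N_def)
  have "i mod m = j mod m"
  proof (rule sync[OF neq[OF k0N] neq[OF k1N]])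
    fix k assume "k < q"
    then show "(h (w ! k0) @ h (w ! ((k0 + 1) mod N))) ! (i mod m + k) =
        (h (w ! k1) @ h (w ! ((k1 + 1) mod N))) ! (j mod m + k)"
      using image_window[of i k w] image_window[of j k w] run[of k] ij l q_le
      by (simp add: N_def k0_def k1_def)
  qed (use m_pos in auto)
  then have i: "i = m * k0 + s" and j: "j = m * k1 + s" and s: "s < m"
    using m_pos by (auto simp: k0_def k1_def s_def) (metis mult_div_mod_eq)
  have k01: "k0 < k1" using ij i j by simp
  define p where "p = k1 - k0"
  have k1: "k1 = k0 + p" and p0: "0 < p" and pN: "p < N" using k01 k1N by (auto simp: p_def)
  have jip: "j - i = m * p" using i j k1 by (simp add: algebra_simps)
  define eq where "eq t \<longleftrightarrow> w ! (k0 + t) = w ! (k1 + t)" for t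
  \<comment> \<open>Relative to \<open>k0\<close>, block \<open>Q\<close> holds the last letter of
    the run, as its \<open>r\<close>-th letter. The shift by 1 gives \<open>r = m\<close> instead of
    0 when the run stops at a block end.\<close>
  define Q r where "Q = (s + l - 1) div m" and "r = (s + l - 1) mod m + 1"
  have sl: "s + l = m * Q + r" using l q_pos by (simp add: Q_def r_def)
  have r: "0 < r" "r \<le> m" using m_pos by (auto simp: r_def Suc_le_eq)
  have "m * (k1 + Q) + r \<le> m * N" using ij(2) sl j by (simp add: algebra_simps N_def)
  then have "m * (k1 + Q) < m * N" using r by linarith
  then have k1Q: "k1 + Q < N" by simp
  have match: "h (w ! (k0 + t)) ! u = h (w ! (k1 + t)) ! u"
    if "u < m" "s \<le> m * t + u" "m * t + u < s + l" "t \<le> Q" for t u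
  proof -
    have "concat (map h w) ! (m * (k0 + t) + u) = concat (map h w) ! (m * (k1 + t) + u)"
      using run[of "m * t + u - s"] that i j by (simp add: algebra_simps)
    then show ?thesis using that k1Q k01 by (simp add: image_nth N_def)
  qed
  have source: "3 * x + 1 \<le> p \<and> 3 * x + 1 \<le> N - p"
    if E: "\<And>t. a \<le> t \<Longrightarrow> t < a + x \<Longrightarrow> eq t" and "a + x \<le> Q + 1" for a x
  proof -
    have "w ! ((k0 + a + k) mod N) = w ! ((k0 + a + p + k) mod N)" if "k < x" for k
      using E[of "a + k"] that \<open>a + x \<le> Q + 1\<close> k1Q by (simp add: eq_def k1 algebra_simps)
    \<comment> \<open>Going forward by \<open>N - p\<close> from the later occurrence wraps around
      to the earlier one.\<close>
    moreover have "w ! ((k1 + a + k) mod N) = w ! ((k1 + a + (N - p) + k) mod N)" if "k < x" for k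
    proof -
      have "k1 + a + (N - p) + k = k0 + a + k + N" using k1 pN by simp
      then show ?thesis
        using E[of "a + k"] that \<open>a + x \<le> Q + 1\<close> k1Q by (simp add: eq_def k1 algebra_simps)
    qed
    ultimately show ?thesis
      using circ_freeD[OF w, of p x "k0 + a"] circ_freeD[OF w, of "N - p" x "k1 + a"] p0 pN
      by (simp add: N_def)
  qed
  have "\<exists>x. 3 * l + d \<le> m * (3 * x + 1) \<and> 3 * x + 1 \<le> p \<and> 3 * x + 1 \<le> N - p"
  proof (cases "Q = 0")
    \<comment> \<open>Inside one block \<open>sync_letter\<close> identifies the two letters, so
      \<open>x = 1\<close> works: \<open>l \<le> m\<close> leaves room up to
      \<open>4 * m\<close>.\<close>
    case True
    then have "s + q \<le> m" using sl r l by simp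
    then have "eq 0" unfolding eq_def
      using sync_letter[of s "w ! k0" "w ! k1"] match[of "s + k" 0 for k] l by simp
    then have "3 * 1 + 1 \<le> p \<and> 3 * 1 + 1 \<le> N - p" by (intro source[of 0]) auto
    moreover have "3 * l + d \<le> m * (3 * 1 + 1)" using True sl r d_le m_pos by simp
    ultimately show ?thesis by blast
  next
    case False
    have full: "eq t" if "0 < t" "t < Q" for t
    proof (rule ccontr)
      assume "\<not> eq t"
      then obtain u where u: "u \<le> ep" "h (w ! (k0 + t)) ! u \<noteq> h (w ! (k1 + t)) ! u"
        using prefix unfolding eq_def by blast
      have "u < m" using u ends m_pos by simp
      moreover have "m * t + m \<le> m * Q"
        using that m_pos by (metis Suc_leI mult_Suc_right mult_le_mono2 add.commute)
      moreover have "s \<le> m * t"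
        using that s by (metis le_trans less_imp_le mult_le_mono2 mult_1_right Suc_leI One_nat_def)
      ultimately show False using match[of u t] u that sl by simp
    qed
    \<comment> \<open>Distinct first letters force the run to start within the last
      \<open>es\<close> letters of a block; dually, distinct letters at \<open>Q\<close> confine it
      to the first \<open>ep\<close> letters there.\<close>
    have left: "m \<le> s + es" if neq: "\<not> eq 0"
    proof -
      obtain u where u: "u < m" "m \<le> u + 1 + es" "h (w ! k0) ! u \<noteq> h (w ! k1) ! u"
        using suffix neq unfolding eq_def by fastforce
      have "m \<le> m * Q" using False by simp
      then have "u < s + l" using u sl by linarith
      then have "u < s" using match[of u 0] u by (cases "s \<le> u") auto
      then show ?thesis using u by simp
    qed
    have right: "r \<le> ep" if neq: "\<not> eq Q"
    proof -
      obtain u where u: "u \<le> ep" "h (w ! (k0 + Q)) ! u \<noteq> h (w ! (k1 + Q)) ! u"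
        using prefix neq unfolding eq_def by blast
      have "u < m" using u ends m_pos by simp
      moreover have "m \<le> m * Q" using False by simp
      ultimately have "s \<le> m * Q + u" using s by linarith
      then have "r \<le> u" using match[of u Q] u sl \<open>u < m\<close> by (cases "r \<le> u") auto
      then show ?thesis using u by simp
    qed
    \<comment> \<open>\<open>a\<close> skips the first block if its letters differ; \<open>x\<close>
      counts the agreeing blocks from there on, without the last one if its letters differ.\<close>
    define a where "a = (if eq 0 then 0 else 1 :: nat)"
    define x where "x = (if eq Q then Q + 1 else Q) - a"
    have "3 * x + 1 \<le> p \<and> 3 * x + 1 \<le> N - p"
    proof (rule source)
      show "a + x \<le> Q + 1" using False by (auto simp: a_def x_def)
      show "eq t" if "a \<le> t" "t < a + x" for t
      proof -
        have "t < Q \<or> t = Q \<and> eq Q" using that False by (auto simp: a_def x_def split: if_splits)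
        moreover have "0 < t \<or> t = 0 \<and> eq 0" using that by (auto simp: a_def split: if_splits)
        ultimately show ?thesis using full by blast
      qed
    qed
    moreover obtain Q' where Q': "Q = Suc Q'" using False by (cases Q) auto
    \<comment> \<open>In all four cases \<open>l \<le> m * x + ep + es\<close>, so by
      \<open>ends\<close> the summand 1 in \<open>3 * x + 1\<close> pays for both partial
      blocks.\<close>
    have "3 * l + d \<le> m * (3 * x + 1)"
      using sl r s left right ends Q' by (auto simp: a_def x_def algebra_simps)
    ultimately show ?thesis by blast
  qed
  then obtain x where x: "3 * l + d \<le> m * (3 * x + 1)" "3 * x + 1 \<le> p" "3 * x + 1 \<le> N - p"
    by blast
  have "3 * l + d \<le> m * p" "3 * l + d \<le> m * (N - p)"
    using x by (meson le_trans mult_le_mono2)+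
  then show thesis using that jip p0 pN N_def by blast
qed

end

text \<open>
  The source word is assumed to end in \<open>a, b\<close> and to begin with \<open>c, e\<close>; the word \<open>U\<close> is inserted
  between its last and its first image. Windows of length \<open>q\<close> that meet \<open>U\<close> occur only once, so a
  repetition of length at least \<open>q\<close> avoids \<open>U\<close>.
\<close>

locale insertion = uniform_map h m q d ep es
  for h :: "'a \<Rightarrow> 'b list" and m q d ep es :: nat +
  fixes U :: "'b list" and a b c e :: 'a
  assumes U: "U \<noteq> []"
    and short_junction: "short_free d (3 * (q - 1) + d - 1) (h a @ h b @ U @ h c @ h e)"
    and junction_unique: "2 * m < i + q \<Longrightarrow> i < j \<Longrightarrow> j < 2 * m + length U \<Longrightarrow>
      \<exists>k<q. (h a @ h b @ U @ h c @ h e) ! (i + k) \<noteq> (h a @ h b @ U @ h c @ h e) ! (j + k)"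
    and junction_new: "2 * m < i + q \<Longrightarrow> i < 2 * m + length U \<Longrightarrow> x \<noteq> y \<Longrightarrow> s < m \<Longrightarrow>
      \<exists>k<q. (h a @ h b @ U @ h c @ h e) ! (i + k) \<noteq> (h x @ h y) ! (s + k)"
begin

section \<open>Circular repetitions in the image of a strict word followed by
  \<open>U\<close>\<close>

context
  fixes w
  assumes w: "circ_free 1 w" and N: "4 \<le> length w"
    and w_ends: "w ! (length w - 2) = a" "w ! (length w - 1) = b" "w ! 0 = c" "w ! 1 = e"
begin

abbreviation "N \<equiv> length w"
abbreviation "F \<equiv> concat (map h w) @ U"
abbreviation "n \<equiv> m * N + length U"
abbreviation "X \<equiv> h a @ h b @ U @ h c @ h e"

lemma length_F: "length F = n"
  by (simp only: length_append length_image)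

lemma F_nth: "i < m * N \<Longrightarrow> F ! i = concat (map h w) ! i"
  by (simp add: nth_append length_image)

lemma neq: "k < N \<Longrightarrow> 0 < r \<Longrightarrow> r \<le> 3 \<Longrightarrow> w ! k \<noteq> w ! ((k + r) mod N)"
  using circ_free_neq[OF w] N by simp

lemma mN: "m * N = m * (N - 2) + 2 * m"
proof -
  have "m * 2 \<le> m * N" using N by (intro mult_le_mono2) simp
  then show ?thesis by (simp add: diff_mult_distrib2)
qed

text \<open>Read cyclically from the last but one block, \<open>F\<close> passes through
  \<open>U\<close> into the first two blocks. This neighbourhood is the fixed word \<open>X\<close>,
  so finite checks on \<open>X\<close> cover every source word.\<close>

lemma junction_nth:
  assumes "t < 4 * m + length U"
  shows "F ! ((m * (N - 2) + t) mod n) = X ! t"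
proof -
  have N2: "Suc (N - 2) = N - 1" "N - 2 < N" using N by auto
  consider "t < 2 * m" | "2 * m \<le> t" "t < 2 * m + length U" | "2 * m + length U \<le> t" by linarith
  then show ?thesis
  proof cases
    case 1
    then have "F ! ((m * (N - 2) + t) mod n) = (h a @ h b) ! t"
      using image_nth2[of "N - 2" w t] mN N w_ends N2 by (simp add: nth_append length_image)
    then show ?thesis using 1 by (auto simp: nth_append len)
  next
    case 2
    then show ?thesis using mN by (auto simp: nth_append length_image len mult_2)
  next
    case 3
    define s where "s = t - (2 * m + length U)"
    have s: "m * (N - 2) + t = s + n" "s < 2 * m" "t = 2 * m + length U + s"
      using 3 assms mN by (auto simp: s_def)
    have "2 * m \<le> m * N" using mN by linarith
    have "(m * (N - 2) + t) mod n = s"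
      using s \<open>2 * m \<le> m * N\<close> by (simp only: s(1) mod_add_self2 mod_less)
    then have "F ! ((m * (N - 2) + t) mod n) = (h c @ h e) ! s"
      using image_nth2[of 0 w s] F_nth[of s] s N w_ends \<open>2 * m \<le> m * N\<close> by simp
    then show ?thesis using s by (auto simp: nth_append len)
  qed
qed

text \<open>A window not contained in the image meets \<open>U\<close>. An equal window elsewhere is
  excluded by \<open>junction_unique\<close> if it also meets \<open>U\<close>, and by
  \<open>junction_new\<close> if it lies in the image.\<close>

lemma window_in_blocks:
  assumes uv: "u < n" "v < n" "u \<noteq> v"
    and eq: "\<And>k. k < q \<Longrightarrow> F ! ((u + k) mod n) = F ! ((v + k) mod n)"
  shows "u + q \<le> m * N"
proof (rule ccontr)
  assume u: "\<not> u + q \<le> m * N"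
  define u' where "u' = u - m * (N - 2)"
  have u': "u = m * (N - 2) + u'" "2 * m < u' + q" "u' < 2 * m + length U"
    using u mN q_le uv by (auto simp: u'_def)
  have X_u: "F ! ((u + k) mod n) = X ! (u' + k)" if "k < q" for k
    using junction_nth[of "u' + k"] that u' q_le by (simp add: add.assoc)
  show False
  proof (cases "v + q \<le> m * N")
    case False
    define v' where "v' = v - m * (N - 2)"
    have v': "v = m * (N - 2) + v'" "2 * m < v' + q" "v' < 2 * m + length U"
      using False mN q_le uv by (auto simp: v'_def)
    have X_v: "F ! ((v + k) mod n) = X ! (v' + k)" if "k < q" for k
      using junction_nth[of "v' + k"] that v' q_le by (simp add: add.assoc)
    have "u' < v' \<or> v' < u'" using uv u' v' by linarith
    then show False
      using junction_unique[of u' v'] junction_unique[of v' u'] u' v' X_u X_v eq by metis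
  next
    case True
    have "v div m < N" using True q_pos m_pos by (simp add: less_mult_imp_div_less mult.commute)
    then have "\<exists>k<q. X ! (u' + k) \<noteq> (h (w ! (v div m)) @ h (w ! ((v div m + 1) mod N))) ! (v mod m + k)"
      using junction_new[OF u'(2,3) neq[of "v div m" 1], of "v mod m"] m_pos by simp
    then obtain k where k: "k < q"
      "X ! (u' + k) \<noteq> (h (w ! (v div m)) @ h (w ! ((v div m + 1) mod N))) ! (v mod m + k)" by blast
    have "F ! ((v + k) mod n) = concat (map h w) ! (v + k)" using True k F_nth by simp
    then show False using k X_u[of k] eq[of k] image_window[of v k w] True q_le by simp
  qed
qed

lemma windows_in_blocks:
  assumes "u < n" "v < n" "u \<noteq> v"
    and "\<And>k. k < q \<Longrightarrow> F ! ((u + k) mod n) = F ! ((v + k) mod n)"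
  shows "u + q \<le> m * N \<and> v + q \<le> m * N"
  using window_in_blocks[OF assms] window_in_blocks[OF assms(2,1)] assms(3,4) by metis

text \<open>Such a run and its shifted copy span few letters: they lie in three consecutive blocks,
  where \<open>short\<close> applies, or in \<open>X\<close>, where \<open>short_junction\<close>
  does.\<close>

lemma no_short_run:
  assumes i: "i < n" and p: "0 < p" and q: "forbidden_run d p < q"
  shows "\<exists>k<forbidden_run d p. F ! ((i + k) mod n) \<noteq> F ! ((i + p + k) mod n)"
proof -
  define R where "R = forbidden_run d p"
  have pP: "p \<le> 3 * (q - 1) + d - 1" using q by (rule forbidden_run_less)
  \<comment> \<open>This is what \<open>q_bound\<close> provides. With an offset of at most
    \<open>m - 1\<close> the span fits into three blocks; with a start of at most
    \<open>2 * m + length U - 1\<close> it fits into \<open>X\<close>.\<close>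
  have W: "p + R \<le> 2 * m + 1" using pP q q_bound q_pos unfolding R_def by linarith
  show ?thesis unfolding R_def[symmetric]
  proof (cases "i + p + R \<le> m * N")
    case True
    \<comment> \<open>The cap \<open>N - 3\<close> keeps three whole blocks available; when it takes
      effect, these three blocks end at \<open>m * N\<close>, beyond which the span does not
      reach.\<close>
    define k where "k = min (i div m) (N - 3)"
    define s where "s = i - m * k"
    have k: "k + 2 < N" using N by (auto simp: k_def)
    have "m * k \<le> m * (i div m)" by (simp add: k_def)
    also have "\<dots> \<le> i" by simp
    finally have i: "i = m * k + s" by (simp add: s_def)
    have sW: "s + p + R \<le> 3 * m"
    proof (cases "i div m \<le> N - 3")
      case True
      then have "s < m" using m_pos by (simp add: s_def k_def minus_mult_div_eq_mod)
      then show ?thesis using W by simp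
    next
      case False
      then have "k = N - 3" by (simp add: k_def)
      then have "m * N = m * k + 3 * m" using N by (simp flip: add_mult_distrib2 add: mult.commute[of 3])
      then show ?thesis using True i by simp
    qed
    let ?T = "h (w ! k) @ h (w ! (k + 1)) @ h (w ! (k + 2))"
    have "distinct [w ! k, w ! (k + 1), w ! (k + 2)]"
      using neq[of k 1] neq[of k 2] neq[of "k + 1" 1] k by simp
    note T = short[OF this]
    have "s + p + forbidden_run d p \<le> length ?T" using sW by (simp add: R_def len)
    from short_freeD[OF T p pP this] obtain t where
      t: "t < R" "?T ! (s + t) \<noteq> ?T ! (s + p + t)"
      unfolding R_def by blast
    have "F ! ((i + t) mod n) = ?T ! (s + t)"
      using True t i F_nth[of "i + t"] image_nth3[OF k, of "s + t"] sW by (simp add: add.assoc)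
    moreover have "F ! ((i + p + t) mod n) = ?T ! (s + p + t)"
      using True t i F_nth[of "i + p + t"] image_nth3[OF k, of "s + p + t"] sW
      by (simp add: add.assoc)
    ultimately show "\<exists>k<R. F ! ((i + k) mod n) \<noteq> F ! ((i + p + k) mod n)"
      using t by metis
  next
    case False
    define s where "s = i - m * (N - 2)"
    have s: "i = m * (N - 2) + s" "s + p + R \<le> 4 * m + length U"
      using False W mN i by (auto simp: s_def)
    have "s + p + forbidden_run d p \<le> length X" using s(2) by (simp add: R_def len)
    from short_freeD[OF short_junction p pP this] obtain t where
      t: "t < R" "X ! (s + t) \<noteq> X ! (s + p + t)"
      unfolding R_def by blast
    have "F ! ((i + t) mod n) = X ! (s + t)"
      using junction_nth[of "s + t"] s t by (simp add: add.assoc)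
    moreover have "F ! ((i + p + t) mod n) = X ! (s + p + t)"
      using junction_nth[of "s + p + t"] s t by (simp add: add.assoc)
    ultimately show "\<exists>k<R. F ! ((i + k) mod n) \<noteq> F ! ((i + p + k) mod n)"
      using t by metis
  qed
qed

text \<open>It suffices to refute the shortest forbidden run. If it is shorter than
  \<open>q\<close>, \<open>no_short_run\<close> applies. Otherwise all its windows avoid
  \<open>U\<close>, so both occurrences lie linearly in the image and \<open>linear_run\<close>
  bounds their distance.\<close>

lemma circ_free_insert: "circ_free d F"
  unfolding circ_free_def length_F
proof (intro allI impI, elim conjE, rule ccontr)
  fix i0 p l assume p: "0 < p" "p < n" and l: "\<not> 3 * l + d \<le> p"
    and run0: "\<forall>k<l. F ! ((i0 + k) mod n) = F ! ((i0 + p + k) mod n)"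
  define R where "R = forbidden_run d p"
  have Rl: "R \<le> l" using forbidden_run_le[OF l d_le] p by (simp add: R_def)
  define i where "i = i0 mod n"
  define j where "j = (i + p) mod n"
  have n: "0 < n" using p by linarith
  then have i: "i < n" by (simp only: i_def mod_less_divisor)
  have j: "j = (if i + p < n then i + p else i + p - n)"
  proof (cases "i + p < n")
    case False
    then have "j = (i + p - n) mod n" by (simp only: j_def le_mod_geq not_less)
    also have "\<dots> = i + p - n" using i p by (intro mod_less) linarith
    finally show ?thesis using False by simp
  qed (simp add: j_def)
  have ij: "i < n" "j < n" "i \<noteq> j"
    using i p by (auto simp: j)
  have run1: "F ! ((i + k) mod n) = F ! ((i + p + k) mod n)" if "k < R" for k
    using run0 that Rl by (simp add: i_def add.assoc mod_add_left_eq)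
  have run: "F ! ((i + k) mod n) = F ! ((j + k) mod n)" if "k < R" for k
    using run1[OF that] by (simp add: j_def mod_add_left_eq)
  have q: "q \<le> R"
    using no_short_run[OF ij(1) p(1)] run1 unfolding R_def by (meson not_le)
  \<comment> \<open>The window slides by one letter at a time. As \<open>U\<close> is nonempty, the
    next start after a window inside the image is still below \<open>n\<close>, so no start wraps
    around.\<close>
  have inside: "i + t + q \<le> m * N \<and> j + t + q \<le> m * N" if "t \<le> R - q" for t
    using that
  proof (induction t)
    case 0
    then show ?case
      using windows_in_blocks[of i j] ij run q by simp
  next
    case (Suc t)
    then have "i + t + q \<le> m * N" "j + t + q \<le> m * N" by simp_all
    moreover have "0 < length U" using U by simp
    ultimately have "i + Suc t < n" "j + Suc t < n" using q_pos by linarith+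
    moreover have "F ! ((i + Suc t + k) mod n) = F ! ((j + Suc t + k) mod n)" if "k < q" for k
      using run[of "Suc t + k"] that Suc.prems by (simp add: add.assoc)
    ultimately show ?case
      using windows_in_blocks[of "i + Suc t" "j + Suc t"] ij by simp
  qed
  have bound: "i + R \<le> m * N" "j + R \<le> m * N" using inside[of "R - q"] q by auto
  have lin: "concat (map h w) ! (i + k) = concat (map h w) ! (j + k)" if "k < R" for k
    using run[OF that] that bound F_nth[of "i + k"] F_nth[of "j + k"] by simp
  have "3 * R + d \<le> p"
  proof (cases "i < j")
    case True
    then have "p = j - i" using p i j by (simp split: if_splits)
    moreover obtain p' where "j - i = m * p'" "3 * R + d \<le> m * p'"
      using linear_run[OF w _ True bound(2) q lin] N by auto
    ultimately show ?thesis by simp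
  next
    case False
    \<comment> \<open>The way forward from \<open>i\<close> to \<open>j\<close> passes through
      \<open>U\<close>, whose length only adds to \<open>m * (N - p')\<close>.\<close>
    then have "p = n - (i - j)" using p i j by (simp split: if_splits)
    moreover obtain p' where "i - j = m * p'" "3 * R + d \<le> m * (N - p')"
      using linear_run[OF w _ _ bound(1) q lin[symmetric]] N False ij by auto
    ultimately show ?thesis by (simp add: diff_mult_distrib2)
  qed
  then show False using less_forbidden_run[of p d] by (simp add: R_def)
qed

end

end

subsection \<open>Executable criteria\<close>

text \<open>Running off the end of a list counts as disagreement, so only runs that fit into the
  word are reported.\<close>

fun agree :: "nat \<Rightarrow> 'a list \<Rightarrow> 'a list \<Rightarrow> bool" where
  "agree 0 ys zs \<longleftrightarrow> True"
| "agree (Suc l) (y # ys) (z # zs) \<longleftrightarrow> y = z \<and> agree l ys zs"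
| "agree (Suc l) _ _ \<longleftrightarrow> False"

fun no_agree :: "nat list \<Rightarrow> 'a list \<Rightarrow> 'a list \<Rightarrow> bool" where
  "no_agree (l # ls) ys (z # zs) \<longleftrightarrow> \<not> agree l ys (z # zs) \<and> no_agree ls ys zs"
| "no_agree _ _ _ \<longleftrightarrow> True"

text \<open>Entry \<open>j\<close> of \<open>ls\<close> is the run length tested at distance
  \<open>j + 1\<close>, because each suffix is compared with its own tail first.\<close>

fun scan :: "nat list \<Rightarrow> 'a list \<Rightarrow> bool" where
  "scan ls [] \<longleftrightarrow> True"
| "scan ls (x # xs) \<longleftrightarrow> no_agree ls (x # xs) xs \<and> scan ls xs"

lemma agree_iff:
  "agree l ys zs \<longleftrightarrow> l \<le> length ys \<and> l \<le> length zs \<and> (\<forall>k<l. ys ! k = zs ! k)"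
  by (induction l ys zs rule: agree.induct) (auto simp: less_Suc_eq_0_disj)

lemma no_agreeD:
  "no_agree ls ys zs \<Longrightarrow> j < length ls \<Longrightarrow> j < length zs \<Longrightarrow> \<not> agree (ls ! j) ys (drop j zs)"
  by (induction ls ys zs arbitrary: j rule: no_agree.induct) (auto simp: nth_Cons split: nat.splits)

lemma scanD:
  "scan ls w \<Longrightarrow> j < length ls \<Longrightarrow> i + Suc j < length w \<Longrightarrow>
    \<not> agree (ls ! j) (drop i w) (drop (i + Suc j) w)"
proof (induction w arbitrary: i)
  case (Cons x xs)
  show ?case
  proof (cases i)
    case 0
    then show ?thesis using Cons.prems no_agreeD[of ls "x # xs" xs j] by simp
  next
    case (Suc i')
    then show ?thesis using Cons by simp
  qed
qed simp

definition short_check :: "nat \<Rightarrow> nat \<Rightarrow> 'a list \<Rightarrow> bool" where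
  "short_check d P w = scan (map (forbidden_run d) [1..<Suc P]) w"

lemma short_check_sound:
  assumes "short_check d P w"
  shows "short_free d P w"
  unfolding short_free_def
proof (intro allI impI, elim conjE)
  fix i p assume p: "0 < p" "p \<le> P" and le: "i + p + forbidden_run d p \<le> length w"
  have "0 < forbidden_run d p" by (simp add: forbidden_run_def)
  moreover have "map (forbidden_run d) [1..<Suc P] ! (p - 1) = forbidden_run d p"
    using p by (subst nth_map) (auto simp del: upt_Suc)
  ultimately have "\<not> agree (forbidden_run d p) (drop i w) (drop (i + p) w)"
    using scanD[of "map (forbidden_run d) [1..<Suc P]" w "p - 1" i] assms p le
    unfolding short_check_def by (simp del: upt_Suc)
  then show "\<exists>k<forbidden_run d p. w ! (i + k) \<noteq> w ! (i + p + k)"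
    using le by (auto simp: agree_iff)
qed

text \<open>
  A run at distance \<open>p\<close> is also one at distance \<open>length w - p\<close>, so half of the distances suffice.
\<close>

definition circ_check :: "nat \<Rightarrow> 'a list \<Rightarrow> bool" where
  "circ_check d w = short_check d (length w div 2) (w @ w)"

lemma circ_check_sound:
  assumes "circ_check d w" "d \<le> 1"
  shows "circ_free d w"
proof -
  let ?N = "length w"
  have half: "3 * l + d \<le> p"
    if p: "0 < p" "p \<le> ?N div 2"
      and run: "\<And>k. k < l \<Longrightarrow> w ! ((i + k) mod ?N) = w ! ((i + p + k) mod ?N)" for i p l
  proof (rule ccontr)
    assume l: "\<not> 3 * l + d \<le> p"
    define R where "R = forbidden_run d p"
    have Rl: "R \<le> l" using forbidden_run_le[OF l assms(2) p(1)] by (simp add: R_def)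
    define s where "s = i mod ?N"
    have "0 < ?N" using p by linarith
    then have s: "s < ?N" by (simp only: s_def mod_less_divisor)
    \<comment> \<open>With a start of at most \<open>length w - 1\<close>, the run and its copy
      therefore fit into the doubled word.\<close>
    have "p + R \<le> ?N + 1" using p unfolding R_def forbidden_run_def by linarith
    then have le: "s + p + R \<le> length (w @ w)" using s by simp
    obtain k where k: "k < R" "(w @ w) ! (s + k) \<noteq> (w @ w) ! (s + p + k)"
      using short_freeD[OF short_check_sound p, of d "w @ w" s] le assms(1)
      unfolding circ_check_def R_def by blast
    have "(w @ w) ! t = w ! (t mod ?N)" if "t < 2 * ?N" for t
      using that by (cases "t < ?N") (simp_all add: nth_append le_mod_geq)
    then have "w ! ((s + k) mod ?N) \<noteq> w ! ((s + p + k) mod ?N)" using k le by simp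
    then show False using run[of k] k Rl by (simp add: s_def add.assoc mod_add_left_eq)
  qed
  show ?thesis unfolding circ_free_def
  proof (intro allI impI, elim conjE)
    fix i p l assume p: "0 < p" "p < ?N"
      and run: "\<forall>k<l. w ! ((i + k) mod ?N) = w ! ((i + p + k) mod ?N)"
    show "3 * l + d \<le> p"
    proof (cases "p \<le> ?N div 2")
      case True
      show ?thesis by (rule half[where i = i]) (use p True run in simp_all)
    next
      case False
      have shifted: "w ! ((i + p + k) mod ?N) = w ! ((i + p + (?N - p) + k) mod ?N)" if "k < l" for k
      proof -
        have "i + p + (?N - p) + k = i + k + ?N" using p by simp
        then show ?thesis using run[rule_format, OF that] by (simp only: mod_add_self2)
      qed
      have "3 * l + d \<le> ?N - p"
      proof (rule half[where i = "i + p"])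
        show "0 < ?N - p" "?N - p \<le> ?N div 2" using False p by linarith+
      qed (rule shifted)
      then show ?thesis using False by linarith
    qed
  qed
qed

section \<open>Explicit morphisms, insertions and base words\<close>

datatype letter = L0 | L1 | L2 | L3 | L4 | L5 | L6

definition letters :: "letter list" where
  "letters = [L0, L1, L2, L3, L4, L5, L6]"

lemma letters: "x \<in> set letters"
  by (cases x) (auto simp: letters_def)

text \<open>The following words were found by computer search.\<close>

fun step_image :: "letter \<Rightarrow> letter list" where
  "step_image L0 =
    [L4, L0, L3, L1, L4, L6, L2, L0, L4, L1, L3, L5, L6]"
| "step_image L1 =
    [L4, L3, L1, L5, L2, L4, L6, L3, L0, L4, L1, L5, L6]"
| "step_image L2 =
    [L4, L2, L3, L6, L1, L5, L0, L2, L4, L1, L3, L6, L5]"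
| "step_image L3 =
    [L4, L3, L0, L6, L2, L5, L3, L6, L4, L1, L0, L6, L5]"
| "step_image L4 =
    [L4, L0, L1, L6, L2, L4, L3, L5, L0, L2, L1, L6, L5]"
| "step_image L5 =
    [L4, L3, L2, L5, L0, L6, L2, L3, L4, L1, L2, L6, L5]"
| "step_image L6 =
    [L4, L2, L0, L3, L4, L5, L0, L2, L6, L1, L0, L5, L6]"

fun final_image :: "letter \<Rightarrow> letter list" where
  "final_image L0 =
    [L1, L0, L2, L1, L4, L2, L0, L1, L2, L4, L0, L3, L4, L1, L2, L0, L4, L3]"
| "final_image L1 =
    [L0, L2, L1, L0, L4, L2, L3, L1, L2, L4, L3, L0, L1, L3, L2, L0, L3, L4]"
| "final_image L2 =
    [L2, L1, L0, L2, L3, L1, L4, L0, L1, L3, L2, L4, L3, L1, L2, L0, L3, L4]"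
| "final_image L3 =
    [L2, L1, L4, L0, L3, L1, L0, L4, L2, L3, L4, L1, L2, L4, L0, L1, L4, L3]"
| "final_image L4 =
    [L0, L2, L3, L1, L0, L3, L2, L1, L3, L0, L4, L2, L0, L3, L1, L2, L3, L4]"
| "final_image L5 =
    [L2, L1, L3, L0, L2, L4, L1, L2, L3, L1, L0, L4, L3, L2, L0, L1, L3, L4]"
| "final_image L6 =
    [L0, L2, L4, L1, L3, L2, L1, L4, L2, L3, L0, L1, L3, L4, L2, L0, L4, L3]"

definition step_inserts :: "letter list list" where
  "step_inserts =
    [[L2],
     [L3, L2],
     [L1, L3, L2],
     [L1, L3, L6, L2],
     [L1, L4, L3, L6, L2],
     [L2, L3, L1, L5, L6, L2],
     [L1, L3, L6, L0, L5, L3, L2],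
     [L2, L3, L6, L1, L4, L3, L5, L2],
     [L2, L3, L6, L0, L5, L4, L1, L6, L2],
     [L2, L0, L1, L5, L6, L0, L4, L5, L3, L2],
     [L1, L3, L2, L4, L6, L0, L3, L4, L1, L6, L2],
     [L2, L0, L1, L4, L3, L2, L5, L6, L4, L1, L5, L2],
     [L1, L4, L2, L5, L3, L4, L0, L1, L6, L4, L5, L1, L2]]"

definition final_inserts :: "letter list list" where
  "final_inserts =
    [[L1, L4, L2, L3, L0],
     [L1, L0, L3, L2, L4, L3, L0],
     [L1, L4, L2, L1, L3, L0, L4, L1, L0],
     [L1, L4, L2, L1, L3, L4, L0, L1, L2, L3, L0],
     [L1, L0, L3, L4, L2, L0, L1, L4, L3, L0, L4, L1, L0],
     [L1, L4, L2, L1, L0, L4, L1, L2, L3, L4, L2, L0, L1, L3, L0],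
     [L1, L0, L3, L4, L0, L1, L3, L0, L2, L3, L1, L4, L3, L2, L4, L1, L0],
     [L1, L0, L3, L2, L4, L1, L2, L3, L4, L2, L0, L3, L2, L1, L0, L4, L1, L3, L0],
     [L1, L4, L0, L2, L1, L3, L4, L2, L0, L3, L1, L4, L3, L0, L1, L3, L4, L1, L2, L3, L0]]"

definition base_words :: "letter list list" where
  "base_words =
    [[L0, L1, L2, L3],
     [L0, L1, L2, L3, L4],
     [L0, L1, L2, L3, L4, L5],
     [L0, L1, L2, L3, L4, L5, L6],
     [L0, L1, L2, L3, L4, L1, L5, L6],
     [L0, L1, L2, L3, L4, L1, L5, L3, L6],
     [L0, L1, L2, L3, L0, L4, L1, L3, L5, L6],
     [L0, L1, L2, L3, L0, L4, L5, L6, L1, L3, L4],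
     [L0, L1, L2, L3, L0, L4, L2, L5, L6, L4, L3, L5],
     [L0, L1, L2, L3, L4, L5, L2, L1, L6, L3, L2, L5, L6],
     [L0, L1, L2, L3, L0, L4, L1, L3, L5, L2, L1, L4, L5, L6],
     [L0, L1, L2, L3, L4, L0, L2, L5, L4, L6, L0, L3, L2, L4, L5],
     [L0, L1, L2, L3, L0, L4, L5, L3, L2, L4, L1, L0, L5, L2, L6, L4],
     [L0, L1, L2, L3, L4, L5, L6, L0, L2, L5, L3, L0, L4, L5, L2, L6, L4],
     [L0, L1, L2, L3, L0, L4, L2, L5, L0, L6, L4, L1, L3, L6, L0, L5, L3, L4],
     [L0, L1, L2, L3, L0, L4, L5, L6, L3, L2, L5, L0, L1, L6, L5, L2, L4, L3, L6],
     [L0, L1, L2, L3, L4, L5, L6, L3, L0, L5, L2, L3, L6, L4, L0, L3, L1, L4, L6, L5],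
     [L0, L1, L2, L3, L0, L4, L5, L6, L2, L0, L1, L4, L6, L5, L3, L0, L4, L2, L5, L6, L4],
     [L0, L1, L2, L3, L4, L5, L0, L3, L1, L4, L6, L0, L2, L1, L6, L3, L2, L0, L5, L3, L6, L4],
     [L0, L1, L2, L3, L4, L5, L2, L0, L4, L3, L1, L2, L6, L4, L0, L2, L3, L5, L1, L4, L2, L5,
      L3],
     [L0, L1, L2, L3, L4, L0, L5, L2, L6, L0, L1, L3, L5, L0, L4, L1, L6, L5, L3, L4, L2, L6,
      L3, L5],
     [L0, L1, L2, L3, L4, L0, L2, L5, L3, L0, L4, L1, L5, L6, L3, L2, L0, L4, L5, L3, L1, L0,
      L2, L6, L5],
     [L0, L1, L2, L3, L0, L4, L1, L5, L6, L3, L4, L5, L1, L0, L3, L6, L1, L4, L2, L6, L0, L5,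
      L1, L3, L2, L5],
     [L0, L1, L2, L3, L4, L0, L2, L1, L4, L5, L0, L6, L2, L3, L4, L1, L5, L2, L6, L1, L4, L3,
      L0, L5, L1, L3, L6],
     [L0, L1, L2, L3, L4, L5, L6, L2, L4, L1, L0, L2, L6, L5, L3, L0, L6, L1, L3, L2, L4, L5,
      L0, L6, L3, L4, L2, L6],
     [L0, L1, L2, L3, L4, L0, L2, L1, L5, L6, L4, L1, L3, L5, L2, L4, L0, L6, L1, L3, L4, L2,
      L6, L0, L5, L2, L1, L4, L3],
     [L0, L1, L2, L3, L0, L4, L5, L3, L6, L2, L0, L1, L3, L4, L5, L0, L3, L6, L5, L2, L0, L1,
      L6, L3, L2, L4, L1, L3, L6, L4],
     [L0, L1, L2, L3, L4, L5, L1, L0, L3, L2, L1, L5, L4, L6, L1, L3, L5, L6, L4, L1, L5, L3,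
      L4, L6, L2, L0, L4, L3, L2, L5, L6],
     [L0, L1, L2, L3, L0, L4, L5, L2, L0, L1, L3, L6, L0, L5, L2, L1, L0, L6, L3, L4, L0, L5,
      L3, L2, L4, L5, L1, L6, L3, L5, L2, L4],
     [L0, L1, L2, L3, L0, L4, L2, L1, L0, L3, L4, L5, L1, L6, L2, L3, L0, L5, L4, L6, L3, L2,
      L5, L1, L6, L0, L3, L1, L4, L2, L5, L3, L4],
     [L0, L1, L2, L3, L4, L0, L5, L6, L4, L3, L5, L1, L2, L3, L6, L4, L5, L3, L1, L0, L5, L6,
      L4, L1, L3, L5, L2, L0, L3, L1, L5, L4, L3, L6],
     [L0, L1, L2, L3, L4, L0, L5, L2, L1, L3, L6, L0, L4, L3, L2, L6, L4, L0, L3, L1, L6, L5,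
      L4, L3, L6, L2, L4, L1, L3, L5, L0, L2, L1, L6, L3],
     [L0, L1, L2, L3, L0, L4, L2, L5, L1, L4, L0, L6, L5, L3, L2, L0, L4, L3, L5, L6, L4, L0,
      L5, L1, L4, L2, L0, L3, L6, L2, L4, L1, L5, L3, L4, L6],
     [L0, L1, L2, L3, L0, L4, L5, L1, L0, L6, L4, L2, L0, L3, L6, L5, L2, L4, L3, L5, L6, L0,
      L1, L5, L2, L6, L1, L3, L5, L0, L4, L2, L1, L5, L6, L2, L4],
     [L0, L1, L2, L3, L0, L4, L2, L1, L5, L6, L2, L3, L4, L5, L0, L2, L1, L3, L0, L4, L5, L2,
      L0, L6, L4, L1, L2, L3, L4, L0, L2, L5, L1, L4, L3, L6, L5, L4],
     [L0, L1, L2, L3, L0, L4, L1, L3, L5, L4, L0, L6, L3, L1, L2, L0, L3, L6, L2, L4, L5, L3,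
      L1, L4, L6, L5, L2, L4, L0, L5, L6, L4, L3, L5, L0, L4, L2, L5, L6],
     [L0, L1, L2, L3, L0, L4, L2, L1, L3, L5, L2, L6, L3, L0, L1, L5, L3, L2, L0, L4, L6, L2,
      L3, L4, L1, L5, L0, L3, L6, L2, L4, L0, L5, L2, L6, L0, L3, L2, L5, L4],
     [L0, L1, L2, L3, L0, L4, L1, L5, L2, L6, L4, L0, L5, L6, L2, L3, L1, L0, L2, L4, L5, L0,
      L3, L4, L6, L1, L2, L5, L6, L4, L2, L0, L3, L6, L2, L1, L5, L3, L2, L6, L5],
     [L0, L1, L2, L3, L0, L4, L2, L5, L0, L6, L1, L5, L2, L3, L0, L5, L6, L2, L0, L4, L3, L6,
      L5, L0, L1, L2, L4, L0, L3, L1, L6, L2, L5, L3, L0, L4, L5, L2, L0, L6, L3, L5],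
     [L0, L1, L2, L3, L4, L0, L5, L1, L6, L4, L5, L2, L1, L0, L6, L2, L5, L0, L1, L3, L2, L0,
      L5, L4, L3, L0, L2, L6, L1, L5, L3, L4, L1, L6, L0, L4, L2, L6, L1, L3, L5, L4, L6],
     [L0, L1, L2, L3, L0, L4, L5, L1, L3, L2, L4, L6, L5, L2, L0, L1, L5, L6, L4, L2, L1, L6,
      L0, L2, L5, L1, L3, L0, L6, L1, L4, L5, L3, L2, L6, L4, L0, L3, L1, L2, L5, L3, L4, L6],
     [L0, L1, L2, L3, L0, L4, L1, L3, L5, L2, L4, L6, L5, L0, L4, L2, L3, L5, L1, L0, L6, L2,
      L4, L1, L3, L5, L6, L1, L2, L4, L3, L0, L2, L5, L1, L4, L6, L0, L3, L1, L2, L0, L5, L3,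
      L6],
     [L0, L1, L2, L3, L0, L4, L5, L6, L0, L1, L5, L3, L2, L0, L4, L1, L2, L5, L4, L0, L6, L5,
      L3, L1, L2, L4, L0, L1, L3, L6, L0, L4, L2, L6, L1, L4, L0, L5, L1, L6, L4, L2, L3, L1,
      L5, L4],
     [L0, L1, L2, L3, L0, L4, L1, L3, L2, L5, L4, L6, L0, L3, L5, L2, L0, L1, L3, L2, L6, L4,
      L3, L0, L1, L5, L2, L6, L3, L1, L2, L4, L6, L0, L5, L3, L1, L4, L2, L3, L5, L6, L4, L0,
      L5, L2, L6],
     [L0, L1, L2, L3, L0, L4, L1, L3, L5, L4, L2, L6, L3, L0, L2, L1, L4, L3, L6, L2, L5, L1,
      L0, L3, L2, L1, L5, L6, L3, L1, L2, L6, L0, L5, L4, L2, L1, L6, L4, L0, L5, L2, L4, L6,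
      L3, L1, L4, L5],
     [L0, L1, L2, L3, L4, L0, L2, L5, L6, L3, L0, L5, L1, L3, L4, L2, L6, L0, L4, L1, L6, L5,
      L4, L3, L0, L2, L4, L6, L1, L2, L5, L4, L1, L3, L0, L4, L6, L5, L2, L3, L4, L0, L6, L3,
      L1, L4, L6, L2, L5],
     [L0, L1, L2, L3, L0, L4, L2, L1, L0, L3, L4, L1, L5, L6, L3, L2, L5, L4, L0, L1, L2, L6,
      L4, L1, L3, L6, L0, L1, L5, L6, L2, L4, L1, L6, L3, L2, L0, L1, L3, L5, L6, L4, L1, L5,
      L3, L2, L1, L4, L3, L6],
     [L0, L1, L2, L3, L0, L4, L2, L5, L6, L0, L2, L1, L3, L4, L5, L2, L6, L0, L1, L2, L4, L6,
      L3, L0, L4, L5, L2, L1, L0, L5, L4, L6, L2, L0, L4, L3, L2, L6, L5, L4, L2, L0, L1, L6,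
      L3, L2, L5, L4, L1, L3, L5],
     [L0, L1, L2, L3, L0, L4, L1, L3, L5, L2, L6, L0, L5, L3, L6, L2, L5, L4, L1, L6, L3, L0,
      L4, L5, L3, L1, L0, L5, L2, L3, L0, L6, L5, L4, L3, L1, L0, L2, L4, L1, L3, L0, L4, L6,
      L2, L1, L0, L3, L6, L4, L2, L5]]"

definition final_base_words :: "letter list list" where
  "final_base_words =
    [[L0],
     [L0, L1, L2],
     [L0, L1, L2, L3, L4],
     [L0, L1, L2, L3, L1, L4, L3],
     [L0, L1, L2, L0, L3, L2, L4, L1, L3],
     [L0, L1, L2, L0, L3, L1, L0, L2, L4, L1, L3],
     [L0, L1, L2, L3, L1, L4, L2, L0, L3, L4, L1, L3, L2],
     [L0, L1, L2, L3, L1, L4, L3, L0, L4, L1, L2, L0, L3, L2, L4],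
     [L0, L1, L2, L0, L3, L1, L0, L2, L4, L3, L0, L1, L4, L2, L1, L3, L4],
     [L0, L1, L2, L3, L4, L1, L3, L2, L1, L0, L2, L3, L0, L4, L2, L1, L3, L2, L4],
     [L0, L1, L2, L3, L0, L2, L4, L1, L2, L0, L3, L2, L1, L0, L4, L2, L3, L4, L0, L3, L2],
     [L0, L1, L2, L0, L3, L1, L0, L4, L2, L3, L4, L1, L0, L3, L2, L1, L4, L2, L0, L4, L1, L3,
      L4],
     [L0, L1, L2, L0, L3, L1, L4, L0, L2, L4, L1, L0, L4, L3, L0, L1, L3, L4, L1, L2, L4, L3,
      L2, L1, L3],
     [L0, L1, L2, L3, L1, L4, L2, L1, L3, L2, L4, L1, L0, L4, L3, L1, L2, L0, L1, L3, L0, L2,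
      L4, L3, L2, L1, L4],
     [L0, L1, L2, L0, L3, L4, L2, L1, L0, L4, L1, L3, L2, L0, L1, L2, L4, L0, L3, L2, L1, L4,
      L2, L3, L4, L0, L2, L4, L3],
     [L0, L1, L2, L0, L3, L4, L0, L1, L3, L0, L2, L4, L0, L3, L1, L4, L2, L3, L0, L4, L3, L1,
      L2, L0, L1, L3, L4, L0, L2, L4, L3],
     [L0, L1, L2, L3, L0, L4, L3, L2, L0, L3, L1, L4, L3, L0, L1, L3, L2, L1, L4, L2, L3, L4,
      L1, L3, L0, L1, L4, L3, L1, L0, L2, L1, L4],
     [L0, L1, L2, L0, L3, L1, L4, L0, L2, L1, L0, L4, L2, L3, L4, L0, L1, L4, L2, L1, L3, L0,
      L1, L2, L0, L4, L2, L3, L0, L2, L4, L1, L0, L3, L4],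
     [L0, L1, L2, L0, L3, L1, L4, L2, L3, L4, L1, L3, L0, L2, L4, L3, L2, L1, L4, L2, L3, L1,
      L2, L0, L1, L3, L2, L4, L3, L0, L4, L1, L3, L4, L0, L2, L3],
     [L0, L1, L2, L3, L1, L0, L2, L4, L1, L3, L0, L1, L4, L0, L3, L4, L1, L0, L4, L2, L1, L4,
      L3, L1, L0, L2, L1, L3, L4, L2, L3, L1, L4, L3, L0, L2, L3, L4, L2],
     [L0, L1, L2, L3, L0, L2, L4, L1, L2, L0, L1, L3, L4, L2, L1, L0, L2, L3, L4, L1, L3, L2,
      L4, L0, L3, L4, L2, L0, L1, L4, L0, L2, L4, L3, L2, L1, L3, L4, L0, L3, L2],
     [L0, L1, L2, L0, L3, L1, L0, L4, L1, L3, L0, L2, L1, L4, L3, L1, L0, L3, L2, L4, L1, L3,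
      L4, L2, L1, L4, L0, L1, L3, L2, L4, L3, L0, L1, L4, L2, L0, L3, L4, L0, L2, L1, L3],
     [L0, L1, L2, L3, L4, L2, L1, L3, L2, L4, L1, L2, L3, L1, L0, L3, L2, L0, L1, L2, L4, L1,
      L3, L4, L2, L3, L1, L4, L3, L0, L4, L2, L0, L3, L2, L4, L3, L1, L4, L0, L3, L4, L1, L3,
      L2],
     [L0, L1, L2, L0, L3, L1, L0, L4, L2, L1, L3, L4, L0, L2, L3, L0, L4, L1, L2, L0, L1, L3,
      L4, L2, L3, L1, L0, L4, L3, L0, L2, L3, L4, L1, L3, L0, L4, L2, L0, L3, L4, L0, L1, L3,
      L2, L4, L3],
     [L0, L1, L2, L3, L1, L0, L3, L4, L1, L3, L0, L2, L4, L0, L1, L4, L2, L0, L3, L2, L1, L3,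
      L4, L1, L0, L4, L2, L0, L1, L3, L2, L4, L0, L2, L1, L4, L2, L3, L0, L1, L2, L0, L4, L1,
      L0, L2, L1, L3, L2],
     [L0, L1, L2, L3, L1, L4, L3, L2, L4, L1, L0, L3, L1, L2, L4, L0, L2, L3, L1, L4, L2, L1,
      L0, L2, L4, L0, L3, L1, L0, L4, L3, L2, L0, L3, L4, L1, L0, L2, L4, L3, L2, L1, L3, L0,
      L1, L4, L3, L1, L0, L4, L2],
     [L0, L1, L2, L3, L1, L0, L3, L2, L4, L3, L0, L1, L3, L2, L0, L3, L4, L1, L0, L4, L2, L1,
      L3, L4, L0, L1, L4, L2, L0, L3, L1, L2, L4, L0, L1, L3, L4, L2, L1, L0, L3, L2, L0, L4,
      L3, L0, L1, L3, L2, L1, L0, L2, L4],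
     [L0, L1, L2, L0, L3, L1, L0, L2, L4, L0, L3, L4, L2, L1, L4, L3, L2, L4, L0, L1, L2, L0,
      L3, L4, L0, L2, L4, L1, L0, L4, L3, L1, L4, L0, L2, L1, L0, L3, L1, L2, L4, L3, L0, L4,
      L1, L3, L2, L1, L4, L2, L0, L4, L3, L1, L4],
     [L0, L1, L2, L0, L3, L1, L0, L4, L1, L3, L4, L0, L3, L2, L1, L4, L3, L1, L0, L4, L2, L0,
      L3, L1, L2, L3, L0, L1, L3, L4, L1, L0, L4, L2, L1, L3, L2, L0, L4, L3, L1, L0, L3, L2,
      L4, L1, L3, L4, L0, L2, L4, L3, L2, L1, L0, L2, L3],
     [L0, L1, L2, L0, L3, L4, L2, L1, L4, L3, L2, L4, L0, L1, L3, L4, L1, L2, L4, L3, L0, L1,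
      L4, L0, L2, L4, L1, L0, L3, L1, L2, L0, L4, L1, L3, L0, L1, L2, L3, L4, L1, L0, L2, L1,
      L3, L0, L4, L1, L2, L3, L1, L0, L3, L2, L1, L4, L0, L2, L3],
     [L0, L1, L2, L3, L4, L0, L2, L1, L3, L2, L4, L1, L0, L3, L4, L2, L1, L3, L0, L1, L2, L0,
      L3, L4, L1, L3, L2, L4, L3, L0, L1, L3, L4, L0, L3, L2, L0, L1, L2, L3, L4, L2, L1, L4,
      L0, L1, L3, L0, L2, L3, L1, L2, L4, L0, L1, L4, L3, L2, L4, L1, L3],
     [L0, L1, L2, L0, L3, L1, L4, L0, L2, L4, L1, L2, L3, L1, L0, L3, L2, L1, L3, L4, L1, L0,
      L2, L1, L4, L0, L3, L2, L0, L4, L1, L0, L3, L4, L2, L0, L1, L4, L3, L0, L4, L2, L3, L1,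
      L2, L4, L1, L3, L0, L1, L2, L0, L3, L4, L2, L3, L0, L2, L4, L1, L0, L3, L4],
     [L0, L1, L2, L3, L0, L4, L2, L0, L1, L3, L4, L0, L3, L2, L1, L3, L0, L4, L2, L3, L1, L4,
      L3, L0, L2, L3, L4, L0, L1, L3, L0, L4, L1, L2, L0, L3, L4, L0, L2, L4, L3, L0, L1, L2,
      L0, L4, L1, L3, L4, L2, L1, L4, L3, L0, L4, L1, L2, L4, L0, L2, L3, L1, L0, L3, L4],
     [L0, L1, L2, L0, L3, L4, L1, L0, L4, L2, L1, L3, L0, L1, L2, L3, L4, L0, L3, L1, L0, L2,
      L3, L0, L4, L2, L0, L3, L4, L0, L1, L3, L0, L2, L3, L4, L2, L0, L1, L2, L4, L0, L3, L4,
      L1, L0, L4, L2, L3, L1, L2, L0, L1, L3, L2, L1, L0, L3, L4, L1, L3, L0, L4, L3, L2, L1,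
      L4],
     [L0, L1, L2, L0, L3, L4, L0, L2, L4, L1, L2, L3, L1, L4, L0, L3, L4, L1, L3, L0, L4, L2,
      L1, L0, L3, L1, L4, L2, L3, L0, L2, L4, L0, L1, L3, L2, L1, L0, L3, L4, L0, L2, L3, L0,
      L1, L2, L4, L3, L2, L1, L0, L4, L1, L3, L2, L0, L1, L2, L4, L1, L0, L4, L3, L2, L4, L0,
      L2, L1, L3],
     [L0, L1, L2, L0, L3, L1, L4, L3, L2, L0, L4, L1, L0, L2, L4, L0, L3, L4, L1, L2, L0, L4,
      L3, L2, L1, L3, L4, L2, L3, L0, L2, L4, L1, L3, L2, L1, L4, L3, L0, L2, L3, L4, L2, L0,
      L4, L3, L1, L0, L3, L2, L1, L4, L2, L3, L0, L2, L4, L3, L2, L1, L3, L4, L1, L0, L2, L1,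
      L4, L2, L0, L4, L3],
     [L0, L1, L2, L3, L4, L2, L0, L1, L4, L3, L2, L4, L1, L0, L2, L3, L1, L4, L2, L1, L3, L2,
      L0, L1, L2, L3, L1, L0, L4, L1, L3, L2, L1, L4, L2, L3, L1, L2, L0, L1, L4, L0, L3, L2,
      L4, L1, L2, L3, L0, L1, L4, L3, L1, L2, L4, L0, L3, L4, L1, L2, L3, L1, L4, L3, L2, L1,
      L0, L4, L1, L3, L2, L4, L3],
     [L0, L1, L2, L3, L1, L0, L3, L2, L0, L4, L1, L3, L4, L0, L2, L1, L4, L2, L3, L4, L1, L2,
      L4, L0, L1, L4, L2, L0, L3, L4, L0, L2, L3, L0, L4, L1, L0, L2, L4, L3, L0, L1, L2, L0,
      L4, L3, L2, L4, L0, L3, L4, L1, L2, L4, L3, L2, L1, L4, L2, L3, L1, L0, L4, L1, L3, L0,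
      L1, L4, L3, L2, L4, L1, L0, L4, L3]]"

section \<open>Finite tests for the two locales and their soundness\<close>

definition ends_check :: "(letter \<Rightarrow> 'b list) \<Rightarrow> nat \<Rightarrow> nat \<Rightarrow> nat \<Rightarrow> bool" where
  "ends_check h m ep es \<longleftrightarrow> list_all (\<lambda>x. length (h x) = m) letters \<and>
    list_all (\<lambda>x. list_all (\<lambda>y. x = y \<or>
      take (Suc ep) (h x) \<noteq> take (Suc ep) (h y) \<and>
      drop (m - Suc es) (h x) \<noteq> drop (m - Suc es) (h y)) letters) letters"

text \<open>Only pairs of distinct letters count, as neighbours in a strict word differ. Windows
  inside one block do not depend on \<open>y\<close>; removing such duplicates keeps the comparisons
  small.\<close>

definition windows :: "(letter \<Rightarrow> 'b list) \<Rightarrow> nat \<Rightarrow> nat \<Rightarrow> 'b list list" where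
  "windows h q s = remdups (concat (map (\<lambda>x. map (\<lambda>y. take q (drop s (h x @ h y)))
    (filter (\<lambda>y. x \<noteq> y) letters)) letters))"

fun pairwise_disjoint :: "'c list list \<Rightarrow> bool" where
  "pairwise_disjoint [] \<longleftrightarrow> True"
| "pairwise_disjoint (xs # xss) \<longleftrightarrow>
    list_all (\<lambda>ys. list_all (\<lambda>x. x \<notin> set ys) xs) xss \<and> pairwise_disjoint xss"

definition sync_check :: "(letter \<Rightarrow> 'b list) \<Rightarrow> nat \<Rightarrow> nat \<Rightarrow> bool" where
  "sync_check h m q \<longleftrightarrow> pairwise_disjoint (map (windows h q) [0..<m]) \<and>
    list_all (\<lambda>s. distinct (map (\<lambda>x. take q (drop s (h x))) letters)) [0..<Suc (m - q)]"

definition triples_check :: "(letter \<Rightarrow> 'b list) \<Rightarrow> nat \<Rightarrow> nat \<Rightarrow> bool" where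
  "triples_check h q d \<longleftrightarrow> list_all (\<lambda>x. list_all (\<lambda>y. x = y \<or> list_all (\<lambda>z. x = z \<or> y = z \<or>
    short_check d (3 * (q - 1) + d - 1) (h x @ h y @ h z)) letters) letters) letters"

text \<open>The starts range over the windows meeting \<open>U\<close>: the one at
  \<open>2 * m + 1 - q\<close> ends with the first letter of \<open>U\<close>. The list
  \<open>old\<close> is meant to hold all windows of images of two distinct letters.\<close>

definition junction_check ::
  "'b list list \<Rightarrow> nat \<Rightarrow> nat \<Rightarrow> nat \<Rightarrow> 'b list \<Rightarrow> 'b list \<Rightarrow> 'b list \<Rightarrow> bool" where
  "junction_check old m q d left right U \<longleftrightarrow> U \<noteq> [] \<and>
    short_check d (3 * (q - 1) + d - 1) (left @ U @ right) \<and>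
    distinct (map (\<lambda>i. take q (drop i (left @ U @ right))) [2 * m + 1 - q..<2 * m + length U]) \<and>
    list_all (\<lambda>i. take q (drop i (left @ U @ right)) \<notin> set old) [2 * m + 1 - q..<2 * m + length U]"

lemma pairwise_disjointD:
  "pairwise_disjoint xss \<Longrightarrow> i < j \<Longrightarrow> j < length xss \<Longrightarrow> set (xss ! i) \<inter> set (xss ! j) = {}"
proof (induction xss arbitrary: i j)
  case (Cons xs xss)
  then obtain j' where j: "j = Suc j'" by (cases j) auto
  show ?case
  proof (cases i)
    case 0
    then have "xss ! j' \<in> set xss" using j Cons.prems by simp
    then show ?thesis using 0 j Cons.prems by (auto simp: list_all_iff)
  next
    case (Suc i')
    then show ?thesis using j Cons by simp
  qed
qed simp

lemma window_eqI:
  assumes "s + q \<le> length xs" "s' + q \<le> length ys" "\<And>k. k < q \<Longrightarrow> xs ! (s + k) = ys ! (s' + k)"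
  shows "take q (drop s xs) = take q (drop s' ys)"
  using assms by (intro nth_equalityI) auto

lemma window_in_windows:
  assumes "x \<noteq> y"
  shows "take q (drop s (h x @ h y)) \<in> set (windows h q s)"
proof -
  let ?ws = "\<lambda>x. map (\<lambda>y. take q (drop s (h x @ h y))) (filter (\<lambda>y. x \<noteq> y) letters)"
  have "y \<in> set (filter (\<lambda>y. x \<noteq> y) letters)" using assms letters by simp
  then have "take q (drop s (h x @ h y)) \<in> set (?ws x)" unfolding set_map by (rule imageI)
  moreover have "?ws x \<in> set (map ?ws letters)"
    unfolding set_map[of ?ws] by (rule imageI) (rule letters)
  ultimately show ?thesis unfolding windows_def set_remdups set_concat by (rule UN_I[rotated])
qed

lemma uniform_map_check:
  assumes "ends_check h m ep es" "sync_check h m q" "triples_check h q d"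
    and "d \<le> 1" "3 * (ep + es) + d \<le> m" "0 < q" "q \<le> m" "4 * q + d \<le> 2 * m + 6"
  shows "uniform_map h m q d ep es"
proof
  have m: "0 < m" using assms by simp
  show len: "length (h x) = m" for x
    using assms(1) letters unfolding ends_check_def list_all_iff by blast
  show "\<exists>u\<le>ep. h x ! u \<noteq> h y ! u" if "x \<noteq> y" for x y
  proof (rule ccontr)
    assume "\<not> ?thesis"
    then have "take (Suc ep) (h x) = take (Suc ep) (h y)"
      by (intro nth_equalityI) (auto simp: len)
    then show False
      using assms(1) letters that unfolding ends_check_def list_all_iff by metis
  qed
  show "\<exists>u<m. m \<le> u + 1 + es \<and> h x ! u \<noteq> h y ! u" if "x \<noteq> y" for x y
  proof (rule ccontr)
    assume "\<not> ?thesis"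
    then have "drop (m - Suc es) (h x) = drop (m - Suc es) (h y)"
      by (intro nth_equalityI) (auto simp: len)
    then show False
      using assms(1) letters that unfolding ends_check_def list_all_iff by metis
  qed
  show "s = s'" if "x \<noteq> y" "x' \<noteq> y'" "s < m" "s' < m"
    and "\<And>k. k < q \<Longrightarrow> (h x @ h y) ! (s + k) = (h x' @ h y') ! (s' + k)" for x y x' y' s s'
  proof -
    have eq: "take q (drop s (h x @ h y)) = take q (drop s' (h x' @ h y'))"
      using that assms by (intro window_eqI) (auto simp: len)
    have disj: "set (windows h q i) \<inter> set (windows h q j) = {}" if "i < j" "j < m" for i j
      using pairwise_disjointD[of "map (windows h q) [0..<m]" i j] assms(2) that
      unfolding sync_check_def by simp
    show ?thesis
      using window_in_windows[OF that(1), of q s h] window_in_windows[OF that(2), of q s' h]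
        disj[of s s'] disj[of s' s] that eq by (metis disjoint_iff linorder_neqE_nat)
  qed
  show "x = y" if "s + q \<le> m" "\<And>k. k < q \<Longrightarrow> h x ! (s + k) = h y ! (s + k)" for s x y
  proof -
    have "take q (drop s (h x)) = take q (drop s (h y))"
      using that by (intro window_eqI) (auto simp: len)
    moreover have "distinct (map (\<lambda>x. take q (drop s (h x))) letters)"
      using assms(2) that unfolding sync_check_def list_all_iff by (simp del: upt_Suc)
    ultimately show ?thesis
      using letters inj_onD[of "\<lambda>x. take q (drop s (h x))" "set letters" x y]
      unfolding distinct_map by blast
  qed
  show "short_free d (3 * (q - 1) + d - 1) (h x @ h y @ h z)" if "distinct [x, y, z]" for x y z
  proof (rule short_check_sound)
    have "x \<noteq> y" "x \<noteq> z" "y \<noteq> z" using that by auto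
    then show "short_check d (3 * (q - 1) + d - 1) (h x @ h y @ h z)"
      using assms(3) letters[of x] letters[of y] letters[of z] unfolding triples_check_def list_all_iff by blast
  qed
qed (use assms in auto)

lemma insertion_check:
  assumes h: "uniform_map h m q d ep es"
    and J: "junction_check (concat (map (windows h q) [0..<m])) m q d (h a @ h b) (h c @ h e) U"
  shows "insertion h m q d ep es U a b c e"
proof -
  interpret uniform_map h m q d ep es by (rule h)
  let ?X = "h a @ h b @ U @ h c @ h e"
  let ?I = "[2 * m + 1 - q..<2 * m + length U]"
  have X: "(h a @ h b) @ U @ h c @ h e = ?X" by simp
  note J' = J[unfolded junction_check_def X]
  have lenX: "length ?X = 4 * m + length U" by (simp add: len)
  show ?thesis
  proof
    show "U \<noteq> []" using J' by simp
    show "short_free d (3 * (q - 1) + d - 1) ?X" using J' short_check_sound by blast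
    show "\<exists>k<q. ?X ! (i + k) \<noteq> ?X ! (j + k)"
      if "2 * m < i + q" "i < j" "j < 2 * m + length U" for i j
    proof (rule ccontr)
      assume "\<not> ?thesis"
      then have "take q (drop i ?X) = take q (drop j ?X)"
        using that q_le lenX by (intro window_eqI) (auto simp del: length_append)
      moreover have "i \<in> set ?I" "j \<in> set ?I" using that by auto
      moreover have "inj_on (\<lambda>i. take q (drop i ?X)) (set ?I)"
        using J' unfolding distinct_map by blast
      ultimately show False using that by (metis inj_onD less_irrefl)
    qed
    show "\<exists>k<q. ?X ! (i + k) \<noteq> (h x @ h y) ! (s + k)"
      if "2 * m < i + q" "i < 2 * m + length U" "x \<noteq> y" "s < m" for i x y s
    proof (rule ccontr)
      assume "\<not> ?thesis"
      then have "take q (drop i ?X) = take q (drop s (h x @ h y))"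
        using that q_le lenX by (intro window_eqI) (auto simp: len)
      moreover have "take q (drop i ?X) \<notin> set (concat (map (windows h q) [0..<m]))"
        using J' that unfolding list_all_iff by simp
      moreover have "take q (drop s (h x @ h y)) \<in> set (concat (map (windows h q) [0..<m]))"
        using window_in_windows[OF that(3), of q s h] that(4) unfolding set_concat set_map by force
      ultimately show False by simp
    qed
  qed
qed

text \<open>\<open>ends\<close> is tight: \<open>3 * (2 + 2) + 1 = 13\<close>. The value
  \<open>d = 1\<close> makes the images strict again, so the construction can be iterated.\<close>

lemma step_uniform: "uniform_map step_image 13 5 1 2 2"
proof (rule uniform_map_check)
  show "ends_check step_image 13 2 2" by code_simp
  show "sync_check step_image 13 5" by code_simp
  show "triples_check step_image 5 1" by code_simp
qed simp_all

text \<open>\<open>ends\<close> is tight again: \<open>3 * (2 + 4) + 0 = 18\<close>. With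
  \<open>d = 0\<close> the images are only known to be weakly free, so this morphism is applied
  last.\<close>

lemma final_uniform: "uniform_map final_image 18 7 0 2 4"
proof (rule uniform_map_check)
  show "ends_check final_image 18 2 4" by code_simp
  show "sync_check final_image 18 7" by code_simp
  show "triples_check final_image 7 0" by code_simp
qed simp_all

lemma step_junctions:
  "list_all (junction_check (concat (map (windows step_image 5) [0..<13])) 13 5 1
    (step_image L2 @ step_image L3) (step_image L0 @ step_image L1)) step_inserts"
  by code_simp

lemma final_junctions:
  "list_all (junction_check (concat (map (windows final_image 7) [0..<18])) 18 7 0
    (final_image L1 @ final_image L0) (final_image L3 @ final_image L2)) final_inserts"
  by code_simp

lemma base_words_free: "list_all (circ_check 1) base_words"
  by code_simp

lemma final_base_words_free: "list_all (circ_check 0) final_base_words"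
  by code_simp

lemma length_base_words: "map length base_words = [4..<53]"
  by code_simp

lemma length_step_inserts: "map length step_inserts = [1..<14]"
  by code_simp

lemma length_final_inserts: "map length final_inserts = map (\<lambda>i. 2 * i + 5) [0..<9]"
  by code_simp

lemma length_final_base_words: "map length final_base_words = map (\<lambda>i. 2 * i + 1) [0..<38]"
  by code_simp

lemma set_final_image: "set (final_image x) \<subseteq> {L0, L1, L2, L3, L4}"
  by (cases x) simp_all

lemma set_final_inserts: "list_all (\<lambda>w. set w \<subseteq> {L0, L1, L2, L3, L4}) final_inserts"
  by (simp add: final_inserts_def)

lemma set_final_base_words: "list_all (\<lambda>w. set w \<subseteq> {L0, L1, L2, L3, L4}) final_base_words"
  by (simp add: final_base_words_def)

subsection \<open>Circular words of every length\<close>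

text \<open>The renaming is built letter by letter: a transposition moves \<open>f x\<close> to
  \<open>y\<close> and fixes the values already prescribed, which differ from both.\<close>

lemma ex_inj_map:
  assumes "distinct xs" "distinct ys" "length xs = length ys"
  shows "\<exists>f :: 'a \<Rightarrow> 'a. inj f \<and> map f xs = ys"
  using assms
proof (induction xs arbitrary: ys)
  case Nil
  then show ?case by (intro exI[of _ id]) simp
next
  case (Cons x xs)
  then obtain y ys' where ys: "ys = y # ys'" by (cases ys) auto
  then obtain f :: "'a \<Rightarrow> 'a" where f: "inj f" "map f xs = ys'" using Cons by fastforce
  let ?g = "transpose (f x) y \<circ> f"
  have "?g z = f z" if "z \<in> set xs" for z
  proof -
    have "f z \<in> set ys'" using f that by auto
    then have "f z \<noteq> y" using Cons.prems ys by auto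
    moreover have "f z \<noteq> f x" using f that Cons.prems by (auto dest: injD)
    ultimately show ?thesis by (simp add: transpose_def)
  qed
  then have "map ?g (x # xs) = ys" using f ys by (auto simp: transpose_def)
  moreover have "inj ?g" using f by (simp add: inj_compose)
  ultimately show ?case by blast
qed

text \<open>By strictness the four letters around the seam are pairwise distinct, so some injection
  sends them to the prescribed ones, and injective renaming preserves freeness.\<close>

lemma relabel:
  fixes w :: "'a list"
  assumes w: "circ_free 1 w" and N: "4 \<le> length w" and distinct: "distinct [a, b, c, e]"
  obtains v :: "'a list" where "length v = length w" "circ_free 1 v"
    "v ! (length v - 2) = a" "v ! (length v - 1) = b" "v ! 0 = c" "v ! 1 = e"
proof -
  let ?N = "length w"
  let ?xs = "[w ! (?N - 2), w ! (?N - 1), w ! 0, w ! 1]"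
  have idx: "(?N - 2 + 1) mod ?N = ?N - 1" "(?N - 2 + 2) mod ?N = 0" "(?N - 2 + 3) mod ?N = 1"
    "(?N - 1 + 1) mod ?N = 0" "(?N - 1 + 2) mod ?N = 1" "(0 + 1) mod ?N = 1"
  proof -
    have one: "(1 + ?N) mod ?N = 1" by (subst mod_add_self2) (use N in simp)
    have eqs: "?N - 2 + 1 = ?N - 1" "?N - 2 + 2 = ?N" "?N - 2 + 3 = 1 + ?N"
      "?N - 1 + 1 = ?N" "?N - 1 + 2 = 1 + ?N" using N by auto
    show "(?N - 2 + 1) mod ?N = ?N - 1" "(?N - 2 + 2) mod ?N = 0" "(?N - 2 + 3) mod ?N = 1"
      "(?N - 1 + 1) mod ?N = 0" "(?N - 1 + 2) mod ?N = 1" "(0 + 1) mod ?N = 1"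
      unfolding eqs using N one by simp_all
  qed
  have "w \<noteq> []" using N by auto
  then have "distinct ?xs"
    using circ_free_neq[OF w, of "?N - 2" 1] circ_free_neq[OF w, of "?N - 2" 2]
      circ_free_neq[OF w, of "?N - 2" 3] circ_free_neq[OF w, of "?N - 1" 1]
      circ_free_neq[OF w, of "?N - 1" 2] circ_free_neq[OF w, of 0 1] N
    unfolding idx by simp
  then obtain f :: "'a \<Rightarrow> 'a" where f: "inj f" "map f ?xs = [a, b, c, e]"
    using ex_inj_map[of ?xs "[a, b, c, e]"] distinct by auto
  show thesis
  proof (rule that[of "map f w"])
    show "circ_free 1 (map f w)" using circ_free_map[OF inj_on_subset[OF f(1)] w] by simp
  qed (use f N \<open>w \<noteq> []\<close> in auto)
qed

lemma insert_word:
  fixes h :: "'a \<Rightarrow> 'b list" and w :: "'a list"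
  assumes ins: "insertion h m q d ep es U a b c e" and "distinct [a, b, c, e]"
    and w: "circ_free 1 w" "4 \<le> length w"
  obtains v where "length v = m * length w + length U" "circ_free d v"
    "set v \<subseteq> (\<Union>x. set (h x)) \<union> set U"
proof -
  interpret insertion h m q d ep es U a b c e by (rule ins)
  obtain v where v: "length v = length w" "circ_free 1 v"
    "v ! (length v - 2) = a" "v ! (length v - 1) = b" "v ! 0 = c" "v ! 1 = e"
    using relabel[OF w assms(2)] by metis
  show thesis
  proof (rule that)
    show "circ_free d (concat (map h v) @ U)" using circ_free_insert v w by simp
    show "length (concat (map h v) @ U) = m * length w + length U"
      using length_image v by simp
  qed auto
qed

lemma strict_words:
  assumes "4 \<le> N"
  shows "\<exists>w :: letter list. length w = N \<and> circ_free 1 w"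
  using assms
proof (induction N rule: less_induct)
  case (less N)
  show ?case
  proof (cases "N < 53")
    case True
    then have "N \<in> set (map length base_words)"
      using less.prems unfolding length_base_words set_upt by simp
    then obtain w where "w \<in> set base_words" "length w = N" by auto
    then show ?thesis
      using base_words_free circ_check_sound[of 1 w] by (auto simp: list_all_iff)
  next
    case False
    \<comment> \<open>Subtracting 1 makes the remaining length range over 1 to 13, as the insertion
      must be nonempty. The first length with \<open>k \<ge> 4\<close> is
      \<open>53 = 13 * 4 + 1\<close>.\<close>
    define k where "k = (N - 1) div 13"
    have "N - 13 * k \<in> set (map length step_inserts)"
      using False unfolding length_step_inserts k_def set_upt by auto
    then obtain U where U: "U \<in> set step_inserts" "length U = N - 13 * k" by auto
    have "4 \<le> k" "k < N" "13 * k \<le> N" using False by (auto simp: k_def)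
    moreover obtain w :: "letter list" where "length w = k" "circ_free 1 w"
      using less.IH[of k] calculation by blast
    moreover have "insertion step_image 13 5 1 2 2 U L2 L3 L0 L1"
      using step_junctions U by (intro insertion_check step_uniform) (simp add: list_all_iff)
    ultimately show ?thesis using U by (elim insert_word[where w = w]) auto
  qed
qed

lemma odd_words:
  assumes "odd N"
  shows "\<exists>w. length w = N \<and> circ_free 0 w \<and> set w \<subseteq> {L0, L1, L2, L3, L4}"
proof (cases "N < 77")
  case True
  have "N \<in> set (map length final_base_words)"
    unfolding length_final_base_words set_map set_upt
  proof (rule image_eqI)
    show "N = 2 * (N div 2) + 1" using assms by simp
    show "N div 2 \<in> {0..<38}" using True assms by (auto elim!: oddE)
  qed
  then obtain w where "w \<in> set final_base_words" "length w = N" by auto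
  then show ?thesis
    using final_base_words_free set_final_base_words circ_check_sound[of 0 w]
    by (auto simp: list_all_iff)
next
  case False
  \<comment> \<open>For odd \<open>N\<close> the remainder of \<open>N - 5\<close> modulo 18 is
    even, which leaves the insertion lengths 5, 7, ..., 21. The threshold
    \<open>77 = 18 * 4 + 5\<close> is where \<open>k\<close> reaches 4, the least length of a source
    word.\<close>
  define k where "k = (N - 5) div 18"
  define i where "i = (N - 5) mod 18 div 2"
  have "even ((N - 5) mod 18)" using assms False by (simp add: dvd_mod_iff)
  then have "2 * i = (N - 5) mod 18" by (simp add: i_def)
  then have N: "N = 18 * k + (2 * i + 5)"
    using False mult_div_mod_eq[of 18 "N - 5"] unfolding k_def by linarith
  have "i < 9" by (simp add: i_def less_mult_imp_div_less)
  then have "2 * i + 5 \<in> set (map length final_inserts)" 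
    unfolding length_final_inserts set_map set_upt by simp
  then obtain U where U: "U \<in> set final_inserts" "length U = 2 * i + 5" by (metis imageE set_map)
  have "4 \<le> k" using False by (simp add: k_def)
  then obtain w :: "letter list" where w: "length w = k" "circ_free 1 w"
    using strict_words by blast
  have "insertion final_image 18 7 0 2 4 U L1 L0 L3 L2"
    using final_junctions U by (intro insertion_check final_uniform) (simp add: list_all_iff)
  then obtain v where "length v = 18 * length w + length U" "circ_free 0 v"
    "set v \<subseteq> (\<Union>x. set (final_image x)) \<union> set U"
    using w \<open>4 \<le> k\<close> by (elim insert_word[where w = w]) auto
  moreover have "set U \<subseteq> {L0, L1, L2, L3, L4}"
    using U set_final_inserts by (simp add: list_all_iff)
  moreover have "(\<Union>x. set (final_image x)) \<subseteq> {L0, L1, L2, L3, L4}"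
    using set_final_image by blast
  ultimately show ?thesis
    using N U(2) w(1) by (intro exI[of _ v] conjI) (simp, assumption, meson Un_least order_trans)
qed

section \<open>From cyclic positions to factors and exponents of circular words\<close>

lemma circular_factor_nth:
  assumes "circular_factor z (circular_word w)"
  obtains i where "length z \<le> length w" "\<And>t. t < length z \<Longrightarrow> z ! t = w ! ((i + t) mod length w)"
proof -
  obtain u v ps ss where w: "w = u @ v" and x: "v @ u = ps @ z @ ss"
    using assms unfolding circular_factor_def circular_word_def conjugates_def sublist_def by blast
  have lens: "length w = length ps + length z + length ss"
    using w arg_cong[OF x, of length] by simp
  show thesis
  proof (rule that)
    show "length z \<le> length w" using lens by simp
    fix t assume t: "t < length z"
    have "z ! t = (v @ u) ! (length ps + t)" using t by (simp add: x nth_append)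
    also have "\<dots> = w ! ((length u + length ps + t) mod length w)"
    proof (cases "length ps + t < length v")
      case True
      then show ?thesis by (simp add: w nth_append)
    next
      case False
      then have "(length u + length ps + t) mod length w = length ps + t - length v"
        using lens t w by (simp add: le_mod_geq)
      moreover have "length ps + t - length v < length u" using False lens t w by simp
      ultimately show ?thesis using False by (simp add: w nth_append)
    qed
    finally show "z ! t = w ! ((length u + length ps + t) mod length w)" .
  qed
qed

text \<open>A factor \<open>z\<close> with period \<open>p\<close> is a run of
  \<open>length z - p\<close> letters at distance \<open>p\<close>; exponent above
  \<open>4 / 3\<close> means that three times this run length exceeds \<open>p\<close>.\<close>

lemma circ_free_imp_circular_plus_free:
  assumes "circ_free 0 w"
  shows "circular_plus_free (4 / 3) (circular_word w)"
  unfolding circular_plus_free_def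
proof (intro notI, elim exE conjE)
  fix z assume "z \<noteq> []" and factor: "circular_factor z (circular_word w)"
    and exponent: "word_exponent z > 4 / 3"
  define p where "p = min_period z"
  have "has_period z (length z)" using \<open>z \<noteq> []\<close> by (simp add: has_period_def Suc_le_eq)
  then have "has_period z p" unfolding p_def min_period_def by (rule LeastI)
  then have p: "0 < p" "\<And>i. i + p < length z \<Longrightarrow> z ! (i + p) = z ! i"
    by (auto simp: has_period_def)
  have "real (4 * p) < real (3 * length z)"
    using exponent p by (simp add: word_exponent_def flip: p_def add: field_simps)
  then have long: "4 * p < 3 * length z" by (simp only: of_nat_less_iff)
  obtain i where i: "length z \<le> length w"
    "\<And>t. t < length z \<Longrightarrow> z ! t = w ! ((i + t) mod length w)"
    using circular_factor_nth[OF factor] by metis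
  have "3 * (length z - p) + 0 \<le> p"
  proof (rule circ_freeD[OF assms p(1)])
    show "p < length w" using long i by linarith
    fix k assume "k < length z - p"
    then show "w ! ((i + k) mod length w) = w ! ((i + p + k) mod length w)"
      using p(2)[of k] i(2)[of k] i(2)[of "k + p"] by (simp add: ac_simps)
  qed
  then show False using long by linarith
qed

theorem theorem4p6:
  fixes A :: "'a set" and n :: nat
  assumes "card A = 5"
  shows "\<exists>w. set w \<subseteq> A \<and> length w = 2 * n + 1 \<and> circular_plus_free (4 / 3) (circular_word w)"
proof -
  let ?B = "{L0, L1, L2, L3, L4}"
  obtain v where v: "length v = 2 * n + 1" "circ_free 0 v" "set v \<subseteq> ?B"
    using odd_words[of "2 * n + 1"] by auto
  \<comment> \<open>Infinite sets have \<open>card\<close> 0 by convention, so cardinality 5 implies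
    finiteness.\<close>
  have "finite A" using assms by (metis card.infinite zero_neq_numeral)
  moreover have "card ?B = card A" using assms by simp
  ultimately obtain f where f: "bij_betw f ?B A"
    using finite_same_card_bij[of ?B A] by auto
  have "circ_free 0 (map f v)"
    using circ_free_map[OF _ v(2)] f v(3) by (metis bij_betw_def inj_on_subset)
  moreover have "set (map f v) \<subseteq> A" using f v(3) by (auto simp: bij_betw_def)
  ultimately show ?thesis
    using circ_free_imp_circular_plus_free v(1) by (intro exI[of _ "map f v"]) simp
qed

end
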